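(* Let $\beta_4\approx1.75488$ denote the unique root of $x^3=2x^2-x+1$ lying in $(1,2)$. Let $\beta\in(\beta_4,2)$. Then any continuous map $S_\beta:I_\beta\to I_\beta$ such that $S_\beta|_{X_\beta}=F_\beta$ and such that $S_\beta$ is monotonic on $[0,1/\beta]$ has a $k$-cycle for every $k\in\mathbb N$.
   Context: For $\beta\in(1,2)$ put $I_\beta=[0,\frac1{\beta-1}]$. A $\beta$-expansion of $x\in I_\beta$ is a sequence $(\varepsilon_k)_{k\ge1}\in\{0,1\}^{\mathbb N}$ with $x=\sum_{k\ge1}\varepsilon_k\beta^{-k}$. $X_\beta$ is the set of $x\in I_\beta$ which have a unique $\beta$-expansion; it is disjoint from the interval $[\frac1\beta,\frac1{\beta(\beta-1)}]$. The map $F_\beta:X_\beta\to X_\beta$ is given by $F_\beta(x)=\beta x$ if $0\le x<\frac1\beta$ and $F_\beta(x)=\beta x-1$ if $\frac1{\beta(\beta-1)}<x\le\frac1{\beta-1}$. A $k$-cycle of a map is a periodic orbit of smallest period $k$, i.e. consisting of exactly $k$ distinct points. $\mathbb N=\{1,2,3,\dots\}$. *)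

theory Defs
  imports "HOL-Analysis.Analysis"
begin

definition I_beta :: "real \<Rightarrow> real set" where
  "I_beta \<beta> = {0 .. 1 / (\<beta> - 1)}"

(* Digit sequences are indexed from 0: the value e k is the (k+1)-st digit, with weight \<beta>^-(k+1). *)
definition beta_expansion :: "real \<Rightarrow> real \<Rightarrow> (nat \<Rightarrow> nat) \<Rightarrow> bool" where
  "beta_expansion \<beta> x e \<longleftrightarrow>
     range e \<subseteq> {0, 1} \<and> (\<lambda>k. real (e k) / \<beta> ^ Suc k) sums x"

definition X_beta :: "real \<Rightarrow> real set" where
  "X_beta \<beta> = {x \<in> I_beta \<beta>. \<exists>!e. beta_expansion \<beta> x e}"

(* Only the values on X_beta \<beta> matter; the set X_beta \<beta> is disjoint from the gap
   [1/\<beta>, 1/(\<beta>(\<beta>-1))], where the function is left unspecified. *)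
definition F_beta :: "real \<Rightarrow> real \<Rightarrow> real" where
  "F_beta \<beta> x =
     (if 0 \<le> x \<and> x < 1 / \<beta> then \<beta> * x
      else if 1 / (\<beta> * (\<beta> - 1)) < x \<and> x \<le> 1 / (\<beta> - 1) then \<beta> * x - 1
      else undefined)"

definition beta4 :: real where
  "beta4 = (THE x. 1 < x \<and> x < 2 \<and> x ^ 3 = 2 * x ^ 2 - x + 1)"

lemma beta4_ex1: "\<exists>!x::real. 1 < x \<and> x < 2 \<and> x ^ 3 = 2 * x ^ 2 - x + 1"
proof -
  define f :: "real \<Rightarrow> real" where "f = (\<lambda>x. x ^ 3 - 2 * x ^ 2 + x - 1)"
  have "\<exists>x\<ge>1. x \<le> 2 \<and> f x = 0"
    by (rule IVT') (auto simp: f_def intro!: continuous_intros)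
  then obtain x where x: "1 \<le> x" "x \<le> 2" "f x = 0" by blast
  moreover have "x \<noteq> 1" "x \<noteq> 2" using x(3) by (auto simp: f_def)
  ultimately have 1: "1 < x" "x < 2" "x ^ 3 = 2 * x ^ 2 - x + 1" by (auto simp: f_def)
  have less: "f a < f b" if "1 < a" "a < b" for a b
  proof -
    have "f b - f a = (b - a) * ((a - 1)\<^sup>2 + (b - 1)\<^sup>2 + (a - 1) * (b - 1) + (a - 1) + (b - 1))"
      by (simp add: f_def algebra_simps power2_eq_square power3_eq_cube)
    moreover have "\<dots> > 0"
      using that by (intro mult_pos_pos add_pos_pos) auto
    ultimately show ?thesis by linarith
  qed
  show ?thesis
  proof (rule ex1I[of _ x])
    show "1 < x \<and> x < 2 \<and> x ^ 3 = 2 * x ^ 2 - x + 1" using 1 by blast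
  next
    fix y :: real assume "1 < y \<and> y < 2 \<and> y ^ 3 = 2 * y ^ 2 - y + 1"
    then have "f y = 0" "1 < y" by (auto simp: f_def)
    then show "y = x" using less[of x y] less[of y x] 1(1) x(3) by (cases x y rule: linorder_cases) auto
  qed
qed

definition is_cycle :: "nat \<Rightarrow> ('a \<Rightarrow> 'a) \<Rightarrow> 'a set \<Rightarrow> bool" where
  "is_cycle k f C \<longleftrightarrow> 1 \<le> k \<and>
     (\<exists>x. C = (\<lambda>j. (f ^^ j) x) ` {..<k} \<and> (f ^^ k) x = x \<and>
        (\<forall>j. 0 < j \<and> j < k \<longrightarrow> (f ^^ j) x \<noteq> x))"

end

theory Submission
  imports Defs
begin

text \<open>
  For \<open>\<beta> > \<beta>\<^sub>4\<close> the points with the expansions \<open>(0011)\<^sup>\<infinity> < (0110)\<^sup>\<infinity> < (1001)\<^sup>\<infinity> < (1100)\<^sup>\<infinity>\<close> avoid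
  the gap, so they are a 4-cycle \<open>x\<^sub>1 \<mapsto> x\<^sub>2 \<mapsto> x\<^sub>4 \<mapsto> x\<^sub>3 \<mapsto> x\<^sub>1\<close> of \<open>F\<^sub>\<beta>\<close> inside \<open>X\<^sub>\<beta>\<close> with
  \<open>x\<^sub>1 < x\<^sub>2 < x\<^sub>3 < x\<^sub>4\<close>. Hence the image of \<open>A = [x\<^sub>1, x\<^sub>2]\<close> under \<open>S\<^sub>\<beta>\<close> contains \<open>B = [x\<^sub>2, x\<^sub>3]\<close>, and
  the image of \<open>B\<close> contains \<open>A \<union> B\<close>. The loop \<open>A \<rightarrow> B \<rightarrow> \<dots> \<rightarrow> B \<rightarrow> A\<close> of length \<open>k\<close> yields a point
  fixed by the \<open>k\<close>-th iterate. It has no smaller period, since otherwise it would lie in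
  \<open>A \<inter> B = {x\<^sub>2}\<close>, whereas the image \<open>x\<^sub>4\<close> of \<open>x\<^sub>2\<close> is not in \<open>B\<close>.
\<close>

section \<open>Covering relations between intervals\<close>

text \<open>Take \<open>u\<close> as the last point with value \<open>f x\<close> and
  \<open>v\<close> as the first point after \<open>u\<close> with value \<open>f y\<close>. If
  \<open>f\<close> left \<open>[f x, f y]\<close> between them, the intermediate value theorem would
  give a later return to \<open>f x\<close> or an earlier arrival at \<open>f y\<close>.\<close>

lemma interval_covering_mono:
  fixes f :: "real \<Rightarrow> real"
  assumes cont: "continuous_on {x..y} f" and "x \<le> y" "f x \<le> f y"
  shows "\<exists>u v. x \<le> u \<and> u \<le> v \<and> v \<le> y \<and> f ` {u..v} = {f x..f y}"
proof -
  define P where "P = {t \<in> {x..y}. f t = f x}"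
  define u where "u = Sup P"
  have "closed P"
    unfolding P_def by (rule continuous_closed_preimage_constant[OF cont]) simp
  moreover have bddP: "bdd_above P" unfolding P_def by (auto intro: bdd_aboveI[of _ y])
  moreover have "x \<in> P" using assms by (auto simp: P_def)
  ultimately have "u \<in> P" unfolding u_def by (intro closed_contains_Sup) auto
  then have u: "x \<le> u" "u \<le> y" "f u = f x" by (auto simp: P_def)
  have u_last: "t \<le> u" if "x \<le> t" "t \<le> y" "f t = f x" for t
    using that bddP unfolding u_def by (intro cSup_upper) (auto simp: P_def)

  define Q where "Q = {t \<in> {u..y}. f t = f y}"
  define v where "v = Inf Q"
  have contu: "continuous_on {u..y} f" using cont u by (auto intro: continuous_on_subset)
  have "closed Q"
    unfolding Q_def by (rule continuous_closed_preimage_constant[OF contu]) simp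
  moreover have bddQ: "bdd_below Q" unfolding Q_def by (auto intro: bdd_belowI[of _ u])
  moreover have "y \<in> Q" using u by (auto simp: Q_def)
  ultimately have "v \<in> Q" unfolding v_def by (intro closed_contains_Inf) auto
  then have v: "u \<le> v" "v \<le> y" "f v = f y" by (auto simp: Q_def)
  have v_first: "v \<le> t" if "u \<le> t" "t \<le> y" "f t = f y" for t
    using that bddQ unfolding v_def by (intro cInf_lower) (auto simp: Q_def)

  have cont': "continuous_on {s..t} f" if "u \<le> s" "t \<le> v" for s t
    using contu that v by (auto intro: continuous_on_subset)
  have "f t \<in> {f x..f y}" if t: "u \<le> t" "t \<le> v" for t
  proof (rule ccontr)
    assume "\<not> ?thesis"
    then consider "f t < f x" | "f y < f t" by fastforce
    then show False
    proof cases
      case 1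
      then obtain s where "t \<le> s" "s \<le> v" "f s = f x"
        using IVT'[of f t "f x" v] cont'[of t v] t v assms by auto
      moreover from this have "s = t" using u_last[of s] t u v by auto
      ultimately show False using 1 by simp
    next
      case 2
      then obtain s where "u \<le> s" "s \<le> t" "f s = f y"
        using IVT'[of f u "f y" t] cont'[of u t] t u assms by auto
      moreover from this have "s = t" using v_first[of s] t u v by auto
      ultimately show False using 2 by simp
    qed
  qed
  moreover have "\<exists>t\<in>{u..v}. f t = z" if "z \<in> {f x..f y}" for z
    using IVT'[of f u z v] cont'[of u v] that u v by auto
  ultimately have "f ` {u..v} = {f x..f y}" by (fastforce simp: image_iff)
  then show ?thesis using u v by blast
qed

text \<open>Choose preimages of \<open>p\<close> and \<open>q\<close>; if that of \<open>q\<close>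
  comes first, pass to \<open>- f\<close>.\<close>

lemma interval_covering:
  fixes f :: "real \<Rightarrow> real"
  assumes cont: "continuous_on {a..b} f" and "p \<le> q" and cover: "{p..q} \<subseteq> f ` {a..b}"
  shows "\<exists>u v. a \<le> u \<and> u \<le> v \<and> v \<le> b \<and> f ` {u..v} = {p..q}"
proof -
  have "p \<in> f ` {a..b}" "q \<in> f ` {a..b}" using cover \<open>p \<le> q\<close> by auto
  then obtain x y where xy: "x \<in> {a..b}" "f x = p" "y \<in> {a..b}" "f y = q" by blast
  show ?thesis
  proof (cases "x \<le> y")
    case True
    have "continuous_on {x..y} f" using cont xy by (auto intro: continuous_on_subset)
    from interval_covering_mono[OF this True] xy \<open>p \<le> q\<close> show ?thesis
      by (metis atLeastAtMost_iff order_trans)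
  next
    case False
    have "continuous_on {y..x} (\<lambda>t. - f t)"
      using cont xy by (auto intro: continuous_on_subset continuous_on_minus)
    from interval_covering_mono[OF this] xy \<open>p \<le> q\<close> False
    obtain u v where uv: "y \<le> u" "u \<le> v" "v \<le> x" "(\<lambda>t. - f t) ` {u..v} = {-q..-p}" by auto
    have "f ` {u..v} = uminus ` (\<lambda>t. - f t) ` {u..v}" by (simp add: image_image)
    also have "\<dots> = {p..q}" by (simp add: uv)
    finally have "f ` {u..v} = {p..q}" .
    moreover have "a \<le> u" "v \<le> b" using uv(1,3) xy by auto
    ultimately show ?thesis using uv(2) by blast
  qed
qed

text \<open>Intervals are pulled back from the end of the chain: the induction hypothesis for the
  shifted chain gives \<open>{p..q}\<close>, and a subinterval of the first interval is mapped
  exactly onto it. Continuity of the iterate is carried along because \<open>f\<close> is continuous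
  only on the intervals visited.\<close>

lemma covering_chain:
  fixes f :: "real \<Rightarrow> real"
  assumes "\<And>i. i \<le> n \<Longrightarrow> l i \<le> r i"
    and "\<And>i. i < n \<Longrightarrow> continuous_on {l i..r i} f"
    and "\<And>i. i < n \<Longrightarrow> {l (Suc i)..r (Suc i)} \<subseteq> f ` {l i..r i}"
  shows "\<exists>u v. u \<le> v \<and> (\<forall>i\<le>n. (f ^^ i) ` {u..v} \<subseteq> {l i..r i}) \<and>
    (f ^^ n) ` {u..v} = {l n..r n} \<and> continuous_on {u..v} (f ^^ n)"
  using assms
proof (induction n arbitrary: l r)
  case 0
  then show ?case by (auto intro!: exI[of _ "l 0"] exI[of _ "r 0"])
next
  case (Suc n)
  obtain p q where pq: "p \<le> q" "\<And>i. i \<le> n \<Longrightarrow> (f ^^ i) ` {p..q} \<subseteq> {l (Suc i)..r (Suc i)}"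
    "(f ^^ n) ` {p..q} = {l (Suc n)..r (Suc n)}" "continuous_on {p..q} (f ^^ n)"
    using Suc.IH[of "\<lambda>i. l (Suc i)" "\<lambda>i. r (Suc i)"] Suc.prems by auto
  have "{p..q} \<subseteq> f ` {l 0..r 0}" using pq(2)[of 0] Suc.prems(3)[of 0] by auto
  then obtain u v where uv: "l 0 \<le> u" "u \<le> v" "v \<le> r 0" "f ` {u..v} = {p..q}"
    using interval_covering[of "l 0" "r 0" f p q] Suc.prems(2)[of 0] pq(1) by auto
  have pow: "(f ^^ Suc i) ` {u..v} = (f ^^ i) ` {p..q}" for i
    by (simp only: funpow_Suc_right image_comp[symmetric] uv(4))
  have "(f ^^ i) ` {u..v} \<subseteq> {l i..r i}" if "i \<le> Suc n" for i
    using that uv pow pq(2) by (cases i) (auto simp del: funpow.simps(2))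
  moreover have "continuous_on {u..v} (f ^^ Suc n)"
    unfolding funpow_Suc_right using Suc.prems(2)[of 0] uv pq(4)
    by (intro continuous_on_compose) (auto intro: continuous_on_subset)
  ultimately show ?case using uv(2) pow pq(3) by metis
qed

text \<open>The difference \<open>g x - x\<close> is at most 0 at a preimage of \<open>u\<close> and
  at least 0 at a preimage of \<open>v\<close>. Connectedness of its range makes the order of these
  two points irrelevant.\<close>

lemma fixed_point_covering:
  fixes g :: "real \<Rightarrow> real"
  assumes cont: "continuous_on {u..v} g" and "u \<le> v" and cover: "{u..v} \<subseteq> g ` {u..v}"
  shows "\<exists>x\<in>{u..v}. g x = x"
proof -
  have "u \<in> g ` {u..v}" "v \<in> g ` {u..v}" using cover \<open>u \<le> v\<close> by auto
  then obtain s t where st: "s \<in> {u..v}" "g s = u" "t \<in> {u..v}" "g t = v" by blast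
  have "connected ((\<lambda>x. g x - x) ` {u..v})"
    by (intro connected_continuous_image continuous_intros cont) simp
  then have "0 \<in> (\<lambda>x. g x - x) ` {u..v}"
    by (rule connectedD_interval[of _ "g s - s" "g t - t"]) (use st in auto)
  then show ?thesis by auto
qed

text \<open>The interval \<open>{u..v}\<close> given by the chain lies in the first interval, which
  equals the last one and hence the image of \<open>{u..v}\<close> under the \<open>n\<close>-th
  iterate.\<close>

lemma covering_loop:
  fixes f :: "real \<Rightarrow> real"
  assumes "\<And>i. i \<le> n \<Longrightarrow> l i \<le> r i"
    and "\<And>i. i < n \<Longrightarrow> continuous_on {l i..r i} f"
    and "\<And>i. i < n \<Longrightarrow> {l (Suc i)..r (Suc i)} \<subseteq> f ` {l i..r i}"
    and "l n = l 0" "r n = r 0"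
  shows "\<exists>x. (f ^^ n) x = x \<and> (\<forall>i\<le>n. (f ^^ i) x \<in> {l i..r i})"
proof -
  obtain u v where uv: "u \<le> v" "\<And>i. i \<le> n \<Longrightarrow> (f ^^ i) ` {u..v} \<subseteq> {l i..r i}"
    "(f ^^ n) ` {u..v} = {l n..r n}" "continuous_on {u..v} (f ^^ n)"
    using covering_chain[of n l r f] assms by blast
  have "{u..v} \<subseteq> (f ^^ n) ` {u..v}" using uv(2)[of 0] uv(3) assms by simp
  then obtain x where "x \<in> {u..v}" "(f ^^ n) x = x"
    using fixed_point_covering[OF uv(4,1)] by blast
  then show ?thesis using uv(2) by blast
qed

lemma periodic_point_of_covering:
  fixes f :: "real \<Rightarrow> real"
  assumes abc: "a \<le> b" "b \<le> c" and cont: "continuous_on {a..c} f"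
    and ab: "{b..c} \<subseteq> f ` {a..b}" and bc: "{a..c} \<subseteq> f ` {b..c}"
    and fb: "f b \<notin> {b..c}" and "1 \<le> k"
  shows "\<exists>x\<in>{a..c}. (f ^^ k) x = x \<and> (\<forall>j. 0 < j \<and> j < k \<longrightarrow> (f ^^ j) x \<noteq> x)"
\<comment> \<open>The loop below needs an intermediate visit to \<open>{b..c}\<close>; for period 1
  the interval \<open>{b..c}\<close> covers itself.\<close>
proof (cases "k = 1")
  case True
  have "continuous_on {b..c} f" using cont abc by (auto intro: continuous_on_subset)
  moreover have "{b..c} \<subseteq> f ` {b..c}" using bc abc by auto
  ultimately obtain x where "x \<in> {b..c}" "f x = x"
    using fixed_point_covering abc by blast
  then show ?thesis using True abc by auto
next
  case False
  define l where "l i = (if i = 0 \<or> i = k then a else b)" for i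
  define r where "r i = (if i = 0 \<or> i = k then b else c)" for i
  have "\<exists>x. (f ^^ k) x = x \<and> (\<forall>i\<le>k. (f ^^ i) x \<in> {l i..r i})"
  proof (rule covering_loop)
    show "l i \<le> r i" for i using abc by (auto simp: l_def r_def)
    show "continuous_on {l i..r i} f" for i
      using abc by (intro continuous_on_subset[OF cont]) (auto simp: l_def r_def)
    have "{a..b} \<subseteq> f ` {b..c}" "{b..c} \<subseteq> f ` {b..c}" using bc abc by auto
    then show "{l (Suc i)..r (Suc i)} \<subseteq> f ` {l i..r i}" if "i < k" for i
      using that ab False by (simp add: l_def r_def)
  qed (auto simp: l_def r_def)
  then obtain x where x: "(f ^^ k) x = x" "\<And>i. i \<le> k \<Longrightarrow> (f ^^ i) x \<in> {l i..r i}" by blast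
  have x0: "x \<in> {a..b}" using x(2)[of 0] by (simp add: l_def r_def)
  have x1: "f x \<in> {b..c}" using x(2)[of 1] False \<open>1 \<le> k\<close> by (simp add: l_def r_def)
  have "(f ^^ j) x \<noteq> x" if "0 < j" "j < k" for j
  proof
    assume "(f ^^ j) x = x"
    then have "x \<in> {b..c}" using x(2)[of j] that by (simp add: l_def r_def)
    then have "x = b" using x0 by simp
    then show False using x1 fb by simp
  qed
  then show ?thesis using x x0 abc by auto
qed

section \<open>Unique expansions\<close>

lemma beta_expansion_digit:
  "beta_expansion \<beta> x e \<Longrightarrow> e k = 0 \<or> e k = 1"
  unfolding beta_expansion_def by blast

lemma beta_expansion_shift:
  assumes "1 < \<beta>" "beta_expansion \<beta> x e"
  shows "beta_expansion \<beta> (\<beta> * x - e 0) (\<lambda>k. e (Suc k))"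
proof -
  have "(\<lambda>k. real (e (Suc k)) / \<beta> ^ Suc (Suc k)) sums (x - real (e 0) / \<beta>)"
    using assms sums_Suc_iff[of "\<lambda>k. real (e k) / \<beta> ^ Suc k" "x - e 0 / \<beta>"]
    by (simp add: beta_expansion_def)
  then have "(\<lambda>k. \<beta> * (real (e (Suc k)) / \<beta> ^ Suc (Suc k))) sums (\<beta> * (x - real (e 0) / \<beta>))"
    by (rule sums_mult)
  then have "(\<lambda>k. real (e (Suc k)) / \<beta> ^ Suc k) sums (\<beta> * x - e 0)"
    using assms(1) by (simp add: algebra_simps)
  moreover have "range (\<lambda>k. e (Suc k)) \<subseteq> {0, 1}"
    using assms(2) unfolding beta_expansion_def image_subset_iff by simp
  ultimately show ?thesis by (simp add: beta_expansion_def)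
qed

text \<open>Comparison with the all-zero and the all-one digit sequences, the latter being a
  geometric series.\<close>

lemma beta_expansion_bounds:
  assumes "1 < \<beta>" "beta_expansion \<beta> x e"
  shows "x \<in> I_beta \<beta>"
proof -
  have e: "(\<lambda>k. real (e k) / \<beta> ^ Suc k) sums x"
    using assms(2) by (simp add: beta_expansion_def)
  have d: "real (e k) \<le> 1" for k
    using beta_expansion_digit[OF assms(2), of k] by auto
  have "(\<lambda>k. (1 / \<beta>) * (1 / \<beta>) ^ k) sums ((1 / \<beta>) * (1 / (1 - 1 / \<beta>)))"
    using assms(1) by (intro sums_mult geometric_sums) simp
  also have "(\<lambda>k. (1 / \<beta>) * (1 / \<beta>) ^ k) = (\<lambda>k. 1 / \<beta> ^ Suc k)"
    by (simp add: power_divide)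
  also have "(1 / \<beta>) * (1 / (1 - 1 / \<beta>)) = 1 / (\<beta> - 1)"
    using assms(1) by (simp add: field_simps)
  finally have "(\<lambda>k. 1 / \<beta> ^ Suc k) sums (1 / (\<beta> - 1))" .
  with e have "x \<le> 1 / (\<beta> - 1)"
    by (rule sums_le[rotated]) (use assms(1) d in \<open>auto intro!: divide_right_mono\<close>)
  moreover have "0 \<le> x"
    using sums_le[OF _ sums_zero e] assms(1) by simp
  ultimately show ?thesis by (simp add: I_beta_def)
qed

text \<open>The shifted digits expand \<open>\<beta> * x - e 0\<close>, which must therefore lie in
  \<open>I_beta \<beta>\<close>. To the left of the gap the digit 1 makes it negative; to the right
  the digit 0 makes it too large.\<close>

lemma beta_expansion_first_digit:
  assumes "1 < \<beta>" "beta_expansion \<beta> x e"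
  shows "x < 1 / \<beta> \<Longrightarrow> e 0 = 0" "1 / (\<beta> * (\<beta> - 1)) < x \<Longrightarrow> e 0 = 1"
proof -
  have *: "0 \<le> \<beta> * x - e 0" "\<beta> * x - e 0 \<le> 1 / (\<beta> - 1)"
    using beta_expansion_bounds[OF assms(1) beta_expansion_shift[OF assms]]
    by (auto simp: I_beta_def)
  show "e 0 = 0" if "x < 1 / \<beta>"
    using that * beta_expansion_digit[OF assms(2), of 0] assms(1) by (auto simp: field_simps)
  show "e 0 = 1" if "1 / (\<beta> * (\<beta> - 1)) < x"
  proof (rule ccontr)
    assume "e 0 \<noteq> 1"
    then have "e 0 = 0" using beta_expansion_digit[OF assms(2), of 0] by simp
    with * that assms(1) show False by (simp add: field_simps)
  qed
qed

text \<open>The digits are the itinerary of the orbit. They are the only ones possible because every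
  orbit point avoids the gap, where alone a digit could be chosen freely.\<close>

lemma invariant_subset_X_beta:
  assumes "1 < \<beta>" and I: "A \<subseteq> I_beta \<beta>"
    and gap: "\<And>x. x \<in> A \<Longrightarrow> x < 1 / \<beta> \<or> 1 / (\<beta> * (\<beta> - 1)) < x"
    and inv: "\<And>x. x \<in> A \<Longrightarrow> F_beta \<beta> x \<in> A"
  shows "A \<subseteq> X_beta \<beta>"
proof
  fix x assume "x \<in> A"
  define d :: "real \<Rightarrow> nat" where "d y = (if y < 1 / \<beta> then 0 else 1)" for y
  define z where "z n = (F_beta \<beta> ^^ n) x" for n
  have F: "F_beta \<beta> y = \<beta> * y - d y" if "y \<in> A" for y
    using that gap I by (fastforce simp: F_beta_def d_def I_beta_def)
  have z: "z n \<in> A" for n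
    by (induction n) (auto simp: z_def \<open>x \<in> A\<close> inv)
  have z_Suc: "z (Suc n) = \<beta> * z n - d (z n)" for n
    using F[OF z[of n]] by (simp add: z_def)
  \<comment> \<open>The recursion for \<open>z\<close> telescopes; the remainder tends to 0 since
    the orbit is bounded.\<close>
  have partial: "(\<Sum>k<n. real (d (z k)) / \<beta> ^ Suc k) = x - z n / \<beta> ^ n" for n
  proof (induction n)
    case (Suc n)
    then show ?case using assms(1) by (simp add: z_Suc diff_divide_distrib)
  qed (simp add: z_def)
  have "(\<lambda>n. z n / \<beta> ^ n) \<longlonglongrightarrow> 0"
  proof (rule tendsto_sandwich)
    have *: "0 \<le> z n \<and> z n \<le> 1 / (\<beta> - 1)" for n using z[of n] I by (auto simp: I_beta_def)
    show "eventually (\<lambda>n. 0 \<le> z n / \<beta> ^ n) sequentially" using * assms(1) by simp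
    show "eventually (\<lambda>n. z n / \<beta> ^ n \<le> (1 / (\<beta> - 1)) / \<beta> ^ n) sequentially"
      using * assms(1) by (intro always_eventually allI divide_right_mono) auto
    show "(\<lambda>n. (1 / (\<beta> - 1)) / \<beta> ^ n) \<longlonglongrightarrow> 0"
      using assms(1) by (rule LIMSEQ_divide_realpow_zero)
  qed simp
  then have "(\<lambda>n. x - z n / \<beta> ^ n) \<longlonglongrightarrow> x - 0" by (intro tendsto_intros)
  then have ex: "beta_expansion \<beta> x (\<lambda>k. d (z k))"
    unfolding beta_expansion_def sums_def partial by (auto simp: d_def)
  have "e = (\<lambda>k. d (z k))" if e: "beta_expansion \<beta> x e" for e
  proof -
    \<comment> \<open>Kept conditional, because the induction that proves its premise uses it at
      each step to identify the digit being shifted off.\<close>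
    have step: "e n = d (z n)" if "beta_expansion \<beta> (z n) (\<lambda>k. e (n + k))" for n
      using beta_expansion_first_digit[OF assms(1) that] gap[OF z[of n]] by (auto simp: d_def)
    have "beta_expansion \<beta> (z n) (\<lambda>k. e (n + k))" for n
    proof (induction n)
      case (Suc n)
      from beta_expansion_shift[OF assms(1) Suc] step[OF Suc]
      show ?case by (simp add: z_Suc)
    qed (use e in \<open>simp add: z_def\<close>)
    then show ?thesis using step by auto
  qed
  then show "x \<in> X_beta \<beta>" using ex \<open>x \<in> A\<close> I unfolding X_beta_def by blast
qed

section \<open>The 4-cycle\<close>

text \<open>The cubic inequality says \<open>1 < \<beta> * (\<beta> - 1) ^ 2\<close>, with equality
  at \<open>beta4\<close>, and the right-hand side is strictly increasing beyond 1.\<close>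

lemma beta4_less_imp:
  assumes "beta4 < \<beta>"
  shows "1 < \<beta>" "2 * \<beta> ^ 2 - \<beta> + 1 < \<beta> ^ 3"
proof -
  have b: "1 < beta4" "beta4 ^ 3 = 2 * beta4 ^ 2 - beta4 + 1"
    using theI'[OF beta4_ex1] unfolding beta4_def by blast+
  show "1 < \<beta>" using b assms by simp
  have "\<beta> * (\<beta> - 1) ^ 2 > beta4 * (beta4 - 1) ^ 2"
    using b assms by (intro mult_strict_mono power_strict_mono) auto
  then show "2 * \<beta> ^ 2 - \<beta> + 1 < \<beta> ^ 3"
    using b by (simp add: power2_eq_square power3_eq_cube algebra_simps)
qed

text \<open>Only the inner points matter for avoiding the gap. Exchanging the digits 0 and 1
  reflects \<open>I_beta \<beta>\<close>, swapping \<open>x2\<close> with \<open>x3\<close> and the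
  two ends of the gap, so both conditions reduce to the same cubic inequality.\<close>

lemma four_cycle:
  assumes "beta4 < \<beta>"
  obtains x1 x2 x3 x4 where "x1 < x2" "x2 < x3" "x3 < x4"
    "{x1, x2, x3, x4} \<subseteq> X_beta \<beta>"
    "F_beta \<beta> x1 = x2" "F_beta \<beta> x2 = x4" "F_beta \<beta> x4 = x3" "F_beta \<beta> x3 = x1"
proof -
  note b = beta4_less_imp[OF assms]
  \<comment> \<open>The value of the expansion (0011) repeated, namely
    \<open>(\<beta> + 1) / (\<beta> ^ 4 - 1)\<close> in lowest terms.\<close>
  define x where "x = 1 / ((\<beta> - 1) * (\<beta>\<^sup>2 + 1))"
  define x3 where "x3 = \<beta> * (\<beta> * (\<beta> * x)) - 1"
  have D: "0 < (\<beta> - 1) * (\<beta>\<^sup>2 + 1)" using b by (intro mult_pos_pos) (auto intro: add_pos_pos)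
  have x3': "x3 = (\<beta>\<^sup>2 - \<beta> + 1) / ((\<beta> - 1) * (\<beta>\<^sup>2 + 1))"
    using D unfolding x3_def x_def
    by (simp add: field_simps power2_eq_square)
  have x3_map: "\<beta> * x3 - 1 = x"
    using D unfolding x3' x_def by (simp add: field_simps power2_eq_square)
  have "0 < x" using D by (simp add: x_def)
  have lt12: "x < \<beta> * x" using \<open>0 < x\<close> b by simp
  have x2: "\<beta> * x < 1 / \<beta>"
    using D b unfolding x_def by (simp add: field_simps power2_eq_square power3_eq_cube)
  have x3: "1 / (\<beta> * (\<beta> - 1)) < x3"
  proof -
    have "(\<beta>\<^sup>2 + 1) < \<beta> * (\<beta>\<^sup>2 - \<beta> + 1)"
      using b by (simp add: algebra_simps power2_eq_square power3_eq_cube)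
    then have "(\<beta>\<^sup>2 + 1) / (\<beta> * ((\<beta> - 1) * (\<beta>\<^sup>2 + 1)))
        < \<beta> * (\<beta>\<^sup>2 - \<beta> + 1) / (\<beta> * ((\<beta> - 1) * (\<beta>\<^sup>2 + 1)))"
      using D b by (intro divide_strict_right_mono) auto
    moreover have "\<beta>\<^sup>2 + 1 \<noteq> 0" by (metis D mult_zero_right less_irrefl)
    ultimately show ?thesis using b D by (simp add: x3')
  qed
  have lt34: "x3 < \<beta> * (\<beta> * x)"
  proof -
    have "\<beta> * (\<beta> * x) = \<beta>\<^sup>2 / ((\<beta> - 1) * (\<beta>\<^sup>2 + 1))"
      by (simp add: x_def power2_eq_square)
    then show ?thesis unfolding x3' using D b by (auto intro!: divide_strict_right_mono)
  qed
  have x4: "\<beta> * (\<beta> * x) \<le> 1 / (\<beta> - 1)"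
  proof -
    have "\<beta> * (\<beta> * x) = (\<beta>\<^sup>2 / (\<beta>\<^sup>2 + 1)) * (1 / (\<beta> - 1))"
      by (simp add: x_def power2_eq_square)
    also have "\<dots> \<le> 1 * (1 / (\<beta> - 1))"
      using b by (intro mult_right_mono) (auto simp: divide_le_eq_1 add_nonneg_pos)
    finally show ?thesis by simp
  qed
  have "x3 \<le> 1 / (\<beta> - 1)" using lt34 x4 by simp
  have lt23: "\<beta> * x < x3"
  proof -
    have "0 < (\<beta> - 1)\<^sup>2" using b by simp
    then have "\<beta> < \<beta>\<^sup>2 - \<beta> + 1" by (simp add: power2_eq_square algebra_simps)
    then have "\<beta> / ((\<beta> - 1) * (\<beta>\<^sup>2 + 1)) < x3"
      unfolding x3' using D by (intro divide_strict_right_mono)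
    then show ?thesis by (simp add: x_def)
  qed
  \<comment> \<open>\<open>F_beta\<close> tests \<open>x < 1 / \<beta>\<close> first, so its second
    branch at \<open>x3\<close> also requires this bound.\<close>
  have above: "1 / \<beta> < x3"
    using x3_map \<open>0 < x\<close> b by (simp add: field_simps)
  have F: "F_beta \<beta> x = \<beta> * x" "F_beta \<beta> (\<beta> * x) = \<beta> * (\<beta> * x)"
    "F_beta \<beta> (\<beta> * (\<beta> * x)) = x3" "F_beta \<beta> x3 = x"
  proof -
    have "x < 1 / \<beta>" using lt12 x2 by linarith
    then show "F_beta \<beta> x = \<beta> * x" "F_beta \<beta> (\<beta> * x) = \<beta> * (\<beta> * x)"
      using \<open>0 < x\<close> b x2 by (simp_all add: F_beta_def)
    have "\<not> \<beta> * (\<beta> * x) < 1 / \<beta>" "1 / (\<beta> * (\<beta> - 1)) < \<beta> * (\<beta> * x)"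
      using lt34 above x3 by simp_all
    then show "F_beta \<beta> (\<beta> * (\<beta> * x)) = x3"
      using x4 unfolding F_beta_def x3_def by simp
    show "F_beta \<beta> x3 = x"
      using x3 above \<open>x3 \<le> _\<close> unfolding F_beta_def x3_map by simp
  qed
  have "{x, \<beta> * x, x3, \<beta> * (\<beta> * x)} \<subseteq> X_beta \<beta>"
  proof (rule invariant_subset_X_beta[OF b(1)])
    have "0 < x3" "x \<le> 1 / (\<beta> - 1)" using \<open>0 < x\<close> lt12 lt23 lt34 x4 by linarith+
    then show "{x, \<beta> * x, x3, \<beta> * (\<beta> * x)} \<subseteq> I_beta \<beta>"
      using \<open>0 < x\<close> b(1) lt23 lt34 x4 by (auto simp: I_beta_def)
  qed (use F lt12 x2 x3 lt34 in auto)
  then show ?thesis using that[OF lt12 lt23 lt34 _ F] by blast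
qed

theorem theorem3p1:
  fixes \<beta> :: real and S :: "real \<Rightarrow> real" and k :: nat
  assumes "\<beta> \<in> {beta4<..<2}"
    and "continuous_on (I_beta \<beta>) S"
    and "S ` I_beta \<beta> \<subseteq> I_beta \<beta>"
    and "\<forall>x\<in>X_beta \<beta>. S x = F_beta \<beta> x"
    and "mono_on {0..1 / \<beta>} S \<or> antimono_on {0..1 / \<beta>} S"
    and "1 \<le> k"
  shows "\<exists>C \<subseteq> I_beta \<beta>. is_cycle k S C"
proof -
  obtain x1 x2 x3 x4 where ord: "x1 < x2" "x2 < x3" "x3 < x4"
    and X: "{x1, x2, x3, x4} \<subseteq> X_beta \<beta>"
    and F: "F_beta \<beta> x1 = x2" "F_beta \<beta> x2 = x4" "F_beta \<beta> x4 = x3" "F_beta \<beta> x3 = x1"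
    using four_cycle assms(1) by (metis greaterThanLessThan_iff)
  have S: "S x1 = x2" "S x2 = x4" "S x3 = x1" using X F assms(4) by auto
  have sub: "{x1..x3} \<subseteq> I_beta \<beta>" using X by (auto simp: X_beta_def I_beta_def)
  have cont: "continuous_on {a..b} S" if "x1 \<le> a" "b \<le> x3" for a b
    using sub that by (intro continuous_on_subset[OF assms(2)]) auto
  have "\<exists>x\<in>{x1..x3}. (S ^^ k) x = x \<and> (\<forall>j. 0 < j \<and> j < k \<longrightarrow> (S ^^ j) x \<noteq> x)"
  proof (rule periodic_point_of_covering[OF _ _ cont])
    \<comment> \<open>The endpoint values are \<open>x2\<close> and \<open>x4\<close>, and
      \<open>x3 < x4\<close>.\<close>
    show "{x2..x3} \<subseteq> S ` {x1..x2}"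
    proof
      fix y assume "y \<in> {x2..x3}"
      then show "y \<in> S ` {x1..x2}" using IVT'[of S x1 y x2] cont[of x1 x2] ord S by auto
    qed
    \<comment> \<open>Here the endpoint values \<open>x4\<close> and \<open>x1\<close> come in
      decreasing order, hence \<open>IVT2'\<close>.\<close>
    show "{x1..x3} \<subseteq> S ` {x2..x3}"
    proof
      fix y assume "y \<in> {x1..x3}"
      then show "y \<in> S ` {x2..x3}" using IVT2'[of S x3 y x2] cont[of x2 x3] ord S by auto
    qed
  qed (use ord S assms(6) in auto)
  then obtain x where x: "x \<in> I_beta \<beta>" "(S ^^ k) x = x"
    "\<forall>j. 0 < j \<and> j < k \<longrightarrow> (S ^^ j) x \<noteq> x" using sub by blast
  have "(S ^^ j) x \<in> I_beta \<beta>" for j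
    using x(1) assms(3) by (induction j) auto
  then have "(\<lambda>j. (S ^^ j) x) ` {..<k} \<subseteq> I_beta \<beta>" by blast
  moreover have "is_cycle k S ((\<lambda>j. (S ^^ j) x) ` {..<k})"
    unfolding is_cycle_def using x assms(6) by blast
  ultimately show ?thesis by blast
qed

end
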